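(* Let $a_2,a_3\in\mathbb{R}$, $b\in\mathbb{R}\setminus\{0\}$, and consider the three-stage stochastic Runge-Kutta (SRK) scheme ($s=3$) with coefficients $$A=\begin{pmatrix} a_1 & 0 & 0 \\ a_4 & a_2 & 0 \\ 1-a_3 & 0 & a_3 \end{pmatrix},\quad B^{(1)}=\begin{pmatrix} 0 & 0 & 0 \\ 0 & 0 & 0 \\ 1 & 0 & 0 \end{pmatrix},\quad B^{(2)}=\begin{pmatrix} 0 & 0 & 0 \\ 0 & 0 & 0 \\ -\frac1b & \frac1b & 0 \end{pmatrix},\quad B^{(3)}=\begin{pmatrix} 0 & 0 & 0 \\ b & 0 & 0 \\ 0 & 0 & 0 \end{pmatrix}$$ in the case $a_1=0$ and $a_4=-a_2$. If $a_2\ge0$ and $a_3\ge\frac32$ (and $b\in\mathbb{R}\setminus\{0\}$ is arbitrary), then this (strong order 1.0) scheme is $A$-stable for the linear test equation $\mathrm{d}X_t=\lambda X_t\,\mathrm{d}t+\mu X_t\,\mathrm{d}W_t$ ($\lambda,\mu\in\mathbb{C}$), i.e. $\mathcal{D}_{SDE}\subseteq\mathcal{D}_{SRK}$.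
   Context: A stiffly accurate $s$-stage SRK method with real $s\times s$ coefficient matrices $A,B^{(1)},B^{(2)},B^{(3)}$, applied with constant step size $h>0$ to the scalar test equation $\mathrm{d}X_t=\lambda X_t\,\mathrm{d}t+\mu X_t\,\mathrm{d}W_t$ ($W$ a real Wiener process, Itô sense, $\lambda,\mu\in\mathbb{C}$), computes stages $H=(H_1,\dots,H_s)^T$ from $$H=e\,y_n+\lambda hAH+\mu\Big(I_{(1),n}B^{(1)}+\tfrac{I_{(1,1),n}}{\sqrt h}B^{(2)}+\sqrt h\,B^{(3)}\Big)H,\qquad y_{n+1}=H_s,$$ where $e=(1,\dots,1)^T\in\mathbb{R}^s$, $I_{(1),n}=\sqrt h\,\xi_n$ with $\xi_n\sim N(0,1)$ independent, and $I_{(1,1),n}=\frac12(I_{(1),n}^2-h)$. With $\hat h=\lambda h$ and $k=\mu\sqrt h$ this gives $y_{n+1}=R_n(\hat h,k)\,y_n$, with stability function $$R_n(\hat h,k)=\varepsilon_s^T\Big(I_s-\hat hA-k\big(\xi_nB^{(1)}+\tfrac12(\xi_n^2-1)B^{(2)}+B^{(3)}\big)\Big)^{-1}e,\qquad \varepsilon_s=(0,\dots,0,1)^T\in\mathbb{R}^s,$$ $I_s$ the identity matrix, defined wherever the inverse exists. Put $\hat R(\hat h,k)=\mathrm{E}(|R_n(\hat h,k)|^2)$. Domains of mean-square stability: $\mathcal{D}_{SDE}=\{(\lambda,\mu)\in\mathbb{C}^2: 2\Re(\lambda)+|\mu|^2<0\}$ and $\mathcal{D}_{SRK}=\{(\hat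 h,k)\in\mathbb{C}^2:\hat R(\hat h,k)<1\}$. The method is called $A$-stable if $\mathcal{D}_{SDE}\subseteq\mathcal{D}_{SRK}$, i.e. if $\hat R(\hat h,k)<1$ for all $(\hat h,k)\in\mathbb{C}^2$ with $2\Re(\hat h)+|k|^2<0$. *)

theory Defs
  imports "HOL-Probability.Probability"
begin

text \<open>
  An SRK method with stages indexed by a finite type \<open>'s\<close> is given by its real coefficient matrices
  \<open>A, B1, B2, B3\<close> together with the index \<open>l\<close> of its last stage, whose value is the new
  approximation (stiff accuracy). The index is a parameter because the order of the numeral
  types does not single out the last stage: in type \<open>3\<close> the numerals 3 and 0 denote the same index.
\<close>

definition srk_stages ::
  "real^'s^'s \<Rightarrow> real^'s^'s \<Rightarrow> real^'s^'s \<Rightarrow> real^'s^'s \<Rightarrow> complex \<Rightarrow> complex \<Rightarrow> real \<Rightarrow> real \<Rightarrow>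
   complex \<Rightarrow> complex^'s \<Rightarrow> bool" where
  "srk_stages A B1 B2 B3 lam mu h I1 y H \<longleftrightarrow>
     (let I11 = (I1\<^sup>2 - h) / 2 in
      H = y *s (\<chi> i. 1)
        + map_matrix (\<lambda>a. lam * of_real h * of_real a) A *v H
        + map_matrix (\<lambda>b. mu * of_real b) (I1 *\<^sub>R B1 + (I11 / sqrt h) *\<^sub>R B2 + sqrt h *\<^sub>R B3) *v H)"

definition srk_matrix ::
  "real^'s^'s \<Rightarrow> real^'s^'s \<Rightarrow> real^'s^'s \<Rightarrow> real^'s^'s \<Rightarrow> complex \<Rightarrow> complex \<Rightarrow> real \<Rightarrow> complex^'s^'s" where
  "srk_matrix A B1 B2 B3 hh k x =
     mat 1 - map_matrix (\<lambda>a. hh * of_real a) A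
           - map_matrix (\<lambda>b. k * of_real b) (x *\<^sub>R B1 + ((x\<^sup>2 - 1) / 2) *\<^sub>R B2 + B3)"

text \<open>The stability function; its value is meaningful only where \<^const>\<open>srk_matrix\<close> is invertible.\<close>

definition srk_R ::
  "real^'s^'s \<Rightarrow> real^'s^'s \<Rightarrow> real^'s^'s \<Rightarrow> real^'s^'s \<Rightarrow> 's \<Rightarrow> complex \<Rightarrow> complex \<Rightarrow> real \<Rightarrow> complex" where
  "srk_R A B1 B2 B3 l hh k x = (matrix_inv (srk_matrix A B1 B2 B3 hh k x) *v (\<chi> i. 1)) $ l"

lemma srk_step_eq_srk_R:
  assumes "h > 0" and "I1 = sqrt h * x"
    and "srk_stages A B1 B2 B3 lam mu h I1 y H"
    and inv: "invertible (srk_matrix A B1 B2 B3 (lam * of_real h) (mu * of_real (sqrt h)) x)"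
  shows "H $ l = srk_R A B1 B2 B3 l (lam * of_real h) (mu * of_real (sqrt h)) x * y"
proof -
  let ?S = "srk_matrix A B1 B2 B3 (lam * of_real h) (mu * of_real (sqrt h)) x"
  let ?N = "map_matrix (\<lambda>a. lam * of_real h * of_real a) A"
  let ?C = "I1 *\<^sub>R B1 + ((I1\<^sup>2 - h) / 2 / sqrt h) *\<^sub>R B2 + sqrt h *\<^sub>R B3"
  let ?D = "x *\<^sub>R B1 + ((x\<^sup>2 - 1) / 2) *\<^sub>R B2 + B3"
  have "(I1\<^sup>2 - h) / 2 / sqrt h = sqrt h * ((x\<^sup>2 - 1) / 2)"
  proof -
    have "I1\<^sup>2 - h = sqrt h * sqrt h * (x\<^sup>2 - 1)"
      using assms(1,2) by (simp add: power_mult_distrib right_diff_distrib)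
    moreover have "s * s * t / 2 / s = s * (t / 2)" if "s \<noteq> 0" for s t :: real
      using that by simp
    ultimately show ?thesis using assms(1) by (metis less_numeral_extra(3) real_sqrt_eq_zero_cancel_iff)
  qed
  then have "?C = sqrt h *\<^sub>R ?D"
    using assms(2) by (simp add: scaleR_add_right)
  then have C: "map_matrix (\<lambda>b. mu * of_real b) ?C
      = map_matrix (\<lambda>b. mu * of_real (sqrt h) * of_real b) ?D"
    by (simp add: map_matrix_def vec_eq_iff)
  have "H = y *s (\<chi> i. 1) + ?N *v H + map_matrix (\<lambda>b. mu * of_real b) ?C *v H"
    using assms(3) unfolding srk_stages_def Let_def by simp
  then have "?S *v H = y *s (\<chi> i. 1)"
    unfolding C srk_matrix_def matrix_vector_mult_diff_rdistrib matrix_vector_mul_lid diff_eq_eq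
    by (simp only: ac_simps)
  moreover have "matrix_inv ?S ** ?S = mat 1"
    using someI_ex[OF inv[unfolded invertible_def]] unfolding matrix_inv_def by (rule conjunct2)
  ultimately have "H = matrix_inv ?S *v (y *s (\<chi> i. 1))"
    using matrix_vector_mul_assoc[of "matrix_inv ?S" ?S H] by simp
  then have "H = y *s (matrix_inv ?S *v (\<chi> i. 1))"
    by (simp add: vector_scalar_commute)
  then show ?thesis unfolding srk_R_def by simp
qed

definition D_SDE :: "(complex \<times> complex) set" where
  "D_SDE = {(lam, mu). 2 * Re lam + (norm mu)\<^sup>2 < 0}"

definition srk_R_hat ::
  "'w measure \<Rightarrow> ('w \<Rightarrow> real) \<Rightarrow> real^'s^'s \<Rightarrow> real^'s^'s \<Rightarrow> real^'s^'s \<Rightarrow> real^'s^'s \<Rightarrow> 's \<Rightarrow>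
   complex \<Rightarrow> complex \<Rightarrow> real" where
  "srk_R_hat M X A B1 B2 B3 l hh k = (\<integral>\<omega>. (norm (srk_R A B1 B2 B3 l hh k (X \<omega>)))\<^sup>2 \<partial>M)"

text \<open>
  The first two conditions say that the mean-square value exists and is finite; otherwise the
  integral would take the default value 0, and the pair would be counted as stable.
\<close>

definition D_SRK ::
  "'w measure \<Rightarrow> ('w \<Rightarrow> real) \<Rightarrow> real^'s^'s \<Rightarrow> real^'s^'s \<Rightarrow> real^'s^'s \<Rightarrow> real^'s^'s \<Rightarrow> 's \<Rightarrow>
   (complex \<times> complex) set" where
  "D_SRK M X A B1 B2 B3 l = {(hh, k).
     (AE \<omega> in M. invertible (srk_matrix A B1 B2 B3 hh k (X \<omega>))) \<and>
     integrable M (\<lambda>\<omega>. (norm (srk_R A B1 B2 B3 l hh k (X \<omega>)))\<^sup>2) \<and>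
     srk_R_hat M X A B1 B2 B3 l hh k < 1}"

definition srk_A_stable ::
  "'w measure \<Rightarrow> ('w \<Rightarrow> real) \<Rightarrow> real^'s^'s \<Rightarrow> real^'s^'s \<Rightarrow> real^'s^'s \<Rightarrow> real^'s^'s \<Rightarrow> 's \<Rightarrow> bool" where
  "srk_A_stable M X A B1 B2 B3 l \<longleftrightarrow> D_SDE \<subseteq> D_SRK M X A B1 B2 B3 l"

definition coeff_A :: "real \<Rightarrow> real \<Rightarrow> real \<Rightarrow> real \<Rightarrow> real^3^3" where
  "coeff_A a1 a2 a3 a4 = vector
     [vector [a1,     0,  0],
      vector [a4,     a2, 0],
      vector [1 - a3, 0,  a3]]"

definition coeff_B1 :: "real^3^3" where
  "coeff_B1 = vector
     [vector [0, 0, 0],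
      vector [0, 0, 0],
      vector [1, 0, 0]]"

definition coeff_B2 :: "real \<Rightarrow> real^3^3" where
  "coeff_B2 b = vector
     [vector [0,         0,     0],
      vector [0,         0,     0],
      vector [- (1 / b), 1 / b, 0]]"

definition coeff_B3 :: "real \<Rightarrow> real^3^3" where
  "coeff_B3 b = vector
     [vector [0, 0, 0],
      vector [b, 0, 0],
      vector [0, 0, 0]]"

end

theory Submission
  imports Defs
begin

text \<open>
  With $a_1 = 0$ and $a_4 = -a_2$ the stage equations give
  $R = (p + k \xi + r(\xi^2 - 1)) / (1 - a_3 \hat h)$ with $p = 1 + (1 - a_3) \hat h$ and
  $r = k^2 / (2(1 - a_2 \hat h))$; the parameter $b$ cancels. Since $1, \xi, \xi^2 - 1$ are orthogonal,
  $\hat R < 1$ means $|p|^2 + |k|^2 + 2|r|^2 < |1 - a_3 \hat h|^2$. With $u = -\Re \hat h$, the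
  difference $|1 - a_3 \hat h|^2 - |p|^2 = 2u + (2 a_3 - 1)|\hat h|^2$ is at least $2u + 2u^2$, whereas
  $|k|^2 < 2u$ and $|1 - a_2 \hat h| \ge 1$ give $|k|^2 + 2|r|^2 < 2u + 2u^2$.
\<close>

text \<open>Sorting by powers of \<open>x\<close> reduces the mean square to the first four moments.
  The constant coefficient is \<open>p - r\<close> because \<open>x\<^sup>2 - 1\<close> contributes
  \<open>- r\<close>.\<close>

lemma cmod_linear_Hermite_square:
  fixes p q r :: complex and x :: real
  shows "(cmod (p + q * of_real x + r * of_real (x\<^sup>2 - 1)))\<^sup>2 =
    (cmod (p - r))\<^sup>2 + 2 * Re ((p - r) * cnj q) * x
      + ((cmod q)\<^sup>2 + 2 * Re ((p - r) * cnj r)) * x\<^sup>2 + 2 * Re (q * cnj r) * x ^ 3 + (cmod r)\<^sup>2 * x ^ 4"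
  unfolding cmod_power2 by (simp add: power2_eq_square eval_nat_numeral algebra_simps)

lemma has_bochner_integral_std_normal_moments:
  fixes X :: "'w \<Rightarrow> real"
  assumes X: "distributed M lborel X (\<lambda>x. ennreal (std_normal_density x))"
  shows "has_bochner_integral M X 0"
    and "has_bochner_integral M (\<lambda>\<omega>. (X \<omega>)\<^sup>2) 1"
    and "has_bochner_integral M (\<lambda>\<omega>. (X \<omega>) ^ 3) 0"
    and "has_bochner_integral M (\<lambda>\<omega>. (X \<omega>) ^ 4) 3"
proof -
  \<comment> \<open>Moments of \<open>X\<close> are integrals against its density. There the odd
    ones vanish and the moment of order 2k is (2k)!/(2^k k!), which gives 1 and 3.\<close>
  have *: "has_bochner_integral M (\<lambda>\<omega>. X \<omega> ^ n) c"
    if "has_bochner_integral lborel (\<lambda>x. std_normal_density x * x ^ n) c" for n c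
    using that distributed_integrable[OF X, of "\<lambda>x. x ^ n"] distributed_integral[OF X, of "\<lambda>x. x ^ n"]
    by (simp add: has_bochner_integral_iff)
  show "has_bochner_integral M X 0"
    using *[OF std_normal_moment_odd[of 0]] by simp
  show "has_bochner_integral M (\<lambda>\<omega>. (X \<omega>)\<^sup>2) 1"
    using *[OF std_normal_moment_even[of 1]] by simp
  show "has_bochner_integral M (\<lambda>\<omega>. (X \<omega>) ^ 3) 0"
    using *[OF std_normal_moment_odd[of 1]] by (simp add: numeral_3_eq_3)
  show "has_bochner_integral M (\<lambda>\<omega>. (X \<omega>) ^ 4) 3"
    using *[OF std_normal_moment_even[of 2]] by (simp add: fact_numeral)
qed

lemma (in prob_space) has_bochner_integral_linear_Hermite:
  fixes X :: "'a \<Rightarrow> real" and p q r :: complex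
  assumes X: "distributed M lborel X (\<lambda>x. ennreal (std_normal_density x))"
  shows "has_bochner_integral M (\<lambda>\<omega>. (cmod (p + q * of_real (X \<omega>) + r * of_real ((X \<omega>)\<^sup>2 - 1)))\<^sup>2)
    ((cmod p)\<^sup>2 + (cmod q)\<^sup>2 + 2 * (cmod r)\<^sup>2)"
proof -
  have one: "has_bochner_integral M (\<lambda>\<omega>. c) c" for c :: real
    by (simp add: has_bochner_integral_iff prob_space)
  note moments = has_bochner_integral_std_normal_moments[OF X]
  have "has_bochner_integral M (\<lambda>\<omega>. (cmod (p + q * of_real (X \<omega>) + r * of_real ((X \<omega>)\<^sup>2 - 1)))\<^sup>2)
    ((cmod (p - r))\<^sup>2 + 2 * Re ((p - r) * cnj q) * 0
      + ((cmod q)\<^sup>2 + 2 * Re ((p - r) * cnj r)) * 1 + 2 * Re (q * cnj r) * 0 + (cmod r)\<^sup>2 * 3)"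
    unfolding cmod_linear_Hermite_square
    by (intro has_bochner_integral_add has_bochner_integral_mult_right one moments)
  \<comment> \<open>One of the three copies of |r|^2 completes the square |(p - r) + r|^2 = |p|^2;
    the other two remain.\<close>
  moreover have "(cmod (p - r))\<^sup>2 + ((cmod q)\<^sup>2 + 2 * Re ((p - r) * cnj r)) + (cmod r)\<^sup>2 * 3
      = (cmod p)\<^sup>2 + (cmod q)\<^sup>2 + 2 * (cmod r)\<^sup>2"
    unfolding cmod_power2 by (simp add: power2_eq_square algebra_simps)
  ultimately show ?thesis by (simp only: mult_zero_right mult_1_right add_0_right)
qed

lemma matrix_inv_mult_eqI:
  fixes S :: "'a::field^'n^'n"
  assumes "invertible S" and "S *v v = w"
  shows "matrix_inv S *v w = v"
proof -
  have "matrix_inv S ** S = mat 1"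
    using someI_ex[OF assms(1)[unfolded invertible_def]] unfolding matrix_inv_def by (rule conjunct2)
  then show ?thesis
    using matrix_vector_mul_assoc[of "matrix_inv S" S v] assms(2) by simp
qed

context
  fixes a2 a3 b x :: real and hh k :: complex and S :: "complex^3^3"
  assumes b: "b \<noteq> 0" and d2: "1 - of_real a2 * hh \<noteq> 0" and d3: "1 - of_real a3 * hh \<noteq> 0"
  defines "S \<equiv> srk_matrix (coeff_A 0 a2 a3 (- a2)) coeff_B1 (coeff_B2 b) (coeff_B3 b) hh k x"
begin

lemmas S_entries = srk_matrix_def coeff_A_def coeff_B1_def coeff_B2_def coeff_B3_def map_matrix_def mat_def

text \<open>The matrix is lower triangular and the noise enters only below the diagonal, so the
  determinant depends on neither \<open>x\<close> nor \<open>k\<close>.\<close>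

lemma invertible_srk_matrix: "invertible S"
proof -
  have "det S = (1 - of_real a2 * hh) * (1 - of_real a3 * hh)"
    unfolding S_def by (simp add: det_3 S_entries algebra_simps)
  then show ?thesis using d2 d3 by (simp add: invertible_det_nz)
qed

text \<open>Forward substitution solves the triangular stage system; the stage vector is
  \<open>vector [1, 1 + w, R]\<close>.\<close>

lemma srk_R_eq:
  "srk_R (coeff_A 0 a2 a3 (- a2)) coeff_B1 (coeff_B2 b) (coeff_B3 b) (3 :: 3) hh k x =
    (1 + of_real (1 - a3) * hh + k * of_real x
      + k\<^sup>2 / (2 * (1 - of_real a2 * hh)) * of_real (x\<^sup>2 - 1)) / (1 - of_real a3 * hh)"
    (is "_ = ?R")
proof -
  \<comment> \<open>The deviation of the second stage from the first: by \<open>a4 = - a2\<close>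
    the drift terms of row 2 cancel except for the factor in front of \<open>w\<close>. It is
    proportional to \<open>b\<close>, which the entry \<open>1 / b\<close> of
    \<open>coeff_B2\<close> undoes.\<close>
  define w where "w = of_real b * k / (1 - of_real a2 * hh)"
  define R where "R = ?R"
  have w: "(1 - of_real a2 * hh) * w = of_real b * k"
    using d2 by (simp add: w_def)
  have kw: "k * of_real ((x\<^sup>2 - 1) / 2 * (1 / b)) * w
      = k\<^sup>2 / (2 * (1 - of_real a2 * hh)) * of_real (x\<^sup>2 - 1)"
    using b by (simp add: w_def power2_eq_square)
  have R: "(1 - of_real a3 * hh) * R = 1 + of_real (1 - a3) * hh + k * of_real x
      + k * of_real ((x\<^sup>2 - 1) / 2 * (1 / b)) * w"
    unfolding kw using d3 by (simp add: R_def)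
  have row1: "(S *v vector [1, 1 + w, R]) $ 1 = 1"
    unfolding S_def by (simp add: matrix_vector_mult_def sum_3 S_entries)
  have "(S *v vector [1, 1 + w, R]) $ 2
      = of_real a2 * hh - k * of_real b + (1 - of_real a2 * hh) * (1 + w)"
    unfolding S_def by (simp add: matrix_vector_mult_def sum_3 S_entries)
  also have "\<dots> = 1"
    using w by (simp add: algebra_simps)
  finally have row2: "(S *v vector [1, 1 + w, R]) $ 2 = 1" .
  \<comment> \<open>The opposite entries of \<open>coeff_B2\<close> take the difference of the first
    two stages, so only \<open>w\<close> survives.\<close>
  have "(S *v vector [1, 1 + w, R]) $ 3
      = - (of_real (1 - a3) * hh) - k * of_real (x - (x\<^sup>2 - 1) / 2 * (1 / b))
        - k * of_real ((x\<^sup>2 - 1) / 2 * (1 / b)) * (1 + w) + (1 - of_real a3 * hh) * R"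
    unfolding S_def by (simp add: matrix_vector_mult_def sum_3 S_entries
        mult.commute[of hh "of_real a3"] mult.commute[of "of_real b" 2])
  also have "\<dots> = 1"
    unfolding R of_real_diff by (simp only: algebra_simps) simp
  finally have "S *v vector [1, 1 + w, R] = (\<chi> i. 1)"
    using row1 row2 by (simp add: vec_eq_iff forall_3)
  from matrix_inv_mult_eqI[OF invertible_srk_matrix this] show ?thesis
    by (simp add: srk_R_def S_def R_def)
qed

end

lemma cmod_one_minus_mult_ge_1:
  assumes "a \<ge> 0" and "Re z < 0"
  shows "cmod (1 - of_real a * z) \<ge> 1"
proof -
  have "1 \<le> Re (1 - of_real a * z)"
    using assms by (simp add: mult_nonneg_nonpos)
  also have "\<dots> \<le> cmod (1 - of_real a * z)" by (rule complex_Re_le_cmod)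
  finally show ?thesis .
qed

lemma mean_square_bound:
  fixes z k :: complex and a2 a3 :: real
  assumes st: "2 * Re z + (cmod k)\<^sup>2 < 0" and a2: "a2 \<ge> 0" and a3: "a3 \<ge> 3 / 2"
  shows "(cmod (1 + of_real (1 - a3) * z))\<^sup>2 + (cmod k)\<^sup>2
      + 2 * (cmod (k\<^sup>2 / (2 * (1 - of_real a2 * z))))\<^sup>2 < (cmod (1 - of_real a3 * z))\<^sup>2"
proof -
  define u where "u = - Re z"
  have k: "(cmod k)\<^sup>2 < 2 * u" and u: "u > 0"
    using st zero_le_power2[of "cmod k"] unfolding u_def by linarith+
  have "1 \<le> cmod (1 - of_real a2 * z)"
    using a2 u by (intro cmod_one_minus_mult_ge_1) (simp_all add: u_def)
  then have "cmod (k\<^sup>2 / (2 * (1 - of_real a2 * z))) \<le> (cmod k)\<^sup>2 / 2"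
    unfolding norm_divide norm_mult norm_power by (intro divide_left_mono mult_pos_pos) auto
  also have "\<dots> \<le> u" using k by simp
  finally have "(cmod (k\<^sup>2 / (2 * (1 - of_real a2 * z))))\<^sup>2 \<le> u\<^sup>2"
    by (simp add: power_mono)
  \<comment> \<open>Here \<open>a3 \<ge> 3 / 2\<close> enters, as 2 a3 - 1 \<ge> 2, together with
    |z| \<ge> |Re z|.\<close>
  moreover have "2 * u\<^sup>2 \<le> (2 * a3 - 1) * (cmod z)\<^sup>2"
    using a3 by (intro mult_mono) (simp_all add: cmod_power2 u_def)
  moreover have "(cmod (1 - of_real a3 * z))\<^sup>2 - (cmod (1 + of_real (1 - a3) * z))\<^sup>2
      = 2 * u + (2 * a3 - 1) * (cmod z)\<^sup>2"
    unfolding cmod_power2 u_def by (simp add: power2_eq_square algebra_simps)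
  ultimately show ?thesis using k by linarith
qed

theorem lemma5p9:
  fixes M :: "'w measure" and \<xi> :: "nat \<Rightarrow> 'w \<Rightarrow> real"
    and a1 a2 a3 a4 b :: real and n :: nat
  assumes "prob_space M"
    and "prob_space.indep_vars M (\<lambda>_. borel) \<xi> UNIV"
    and "\<And>m. distributed M lborel (\<xi> m) (\<lambda>x. ennreal (std_normal_density x))"
    and "b \<noteq> 0"
    and "a1 = 0" and "a4 = - a2"
    and "a2 \<ge> 0" and "a3 \<ge> 3 / 2"
  shows "srk_A_stable M (\<xi> n) (coeff_A a1 a2 a3 a4) coeff_B1 (coeff_B2 b) (coeff_B3 b) (3 :: 3)"
  unfolding srk_A_stable_def D_SDE_def D_SRK_def assms(5,6)
proof safe
  interpret prob_space M by fact
  fix z k :: complex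
  assume st: "2 * Re z + (cmod k)\<^sup>2 < 0"
  then have z: "Re z < 0" using zero_le_power2[of "cmod k"] by linarith
  have d2: "1 - of_real a2 * z \<noteq> 0" and d3: "1 - of_real a3 * z \<noteq> 0"
    using cmod_one_minus_mult_ge_1[OF _ z, of a2] cmod_one_minus_mult_ge_1[OF _ z, of a3] assms(7,8) by force+
  note R = srk_R_eq[OF assms(4) d2 d3]
  let ?p = "1 + of_real (1 - a3) * z" and ?r = "k\<^sup>2 / (2 * (1 - of_real a2 * z))"
  let ?E = "((cmod ?p)\<^sup>2 + (cmod k)\<^sup>2 + 2 * (cmod ?r)\<^sup>2) / (cmod (1 - of_real a3 * z))\<^sup>2"
  have E: "has_bochner_integral M
      (\<lambda>\<omega>. (cmod (srk_R (coeff_A 0 a2 a3 (- a2)) coeff_B1 (coeff_B2 b) (coeff_B3 b) 3 z k (\<xi> n \<omega>)))\<^sup>2) ?E"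
    \<comment> \<open>The denominator is deterministic and leaves the expectation. The
      instantiations split only this outer quotient and keep the one inside \<open>?r\<close>
      intact.\<close>
    unfolding R norm_divide[of _ "1 - of_real a3 * z"] power_divide[of "cmod _" "cmod (1 - of_real a3 * z)"]
    by (intro has_bochner_integral_divide_zero has_bochner_integral_linear_Hermite assms(3))
  \<comment> \<open>This holds for every outcome, since invertibility was shown for all real
    \<open>x\<close>.\<close>
  show "AE \<omega> in M. invertible
      (srk_matrix (coeff_A 0 a2 a3 (- a2)) coeff_B1 (coeff_B2 b) (coeff_B3 b) z k (\<xi> n \<omega>))"
    using invertible_srk_matrix[OF assms(4) d2 d3] by simp
  show "integrable M
      (\<lambda>\<omega>. (cmod (srk_R (coeff_A 0 a2 a3 (- a2)) coeff_B1 (coeff_B2 b) (coeff_B3 b) 3 z k (\<xi> n \<omega>)))\<^sup>2)"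
    using E by (rule integrable.intros)
  show "srk_R_hat M (\<xi> n) (coeff_A 0 a2 a3 (- a2)) coeff_B1 (coeff_B2 b) (coeff_B3 b) 3 z k < 1"
    unfolding srk_R_hat_def has_bochner_integral_integral_eq[OF E]
    using mean_square_bound[OF st assms(7,8)] d3 by simp
qed

end
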